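(* Let $t_0<t_1<\cdots<t_N$, let $f:[t_0,t_N]\times\mathbb{R}^d\times\mathbb{R}^P\to\mathbb{R}^d$ be continuous, and twice continuously differentiable in $(z,\theta)$ with these derivatives continuous in all variables, let $L:(\mathbb{R}^d)^N\to\mathbb{R}$, $(z_1,\dots,z_N)\mapsto L(z_1,\dots,z_N)$, be twice continuously differentiable, and let $z_0\in\mathbb{R}^d$ be fixed (independent of $\theta$). For a constant-in-time parameter $\theta\in\mathbb{R}^P$ let $z(t)=z(t;\theta)$ denote the solution of $\dot z(t)=f(t,z(t),\theta)$, $z(t_0)=z_0$. Let $\theta^*\in\mathbb{R}^P$ be such that $z^*(t)=z(t;\theta^* )$ exists on all of $[t_0,t_N]$. Let $a$ be the piecewise continuously differentiable function on $[t_0,t_N]$ with values in $\mathbb{R}^{1\times d}$ (row vectors) determined backward in time by $$\dot a(t)=-a(t)\,\frac{\partial f}{\partial z}\Big|_*\quad\text{on each interval }(t_{i-1},t_i),\ i=1,\dots,N,$$ $$a(t_i^-)=a(t_i^+)-\frac{\partial L}{\partial z_i}\bigl(z^*(t_1),\dots,z^*(t_N)\bigr),\quad i=N,N-1,\dots,1,\qquad a(t_N^+)=0,$$ where $|_*$ denotes evaluation at $(t,z^*(t),\theta^* )$ and $a(t_i^\pm)$ are the one-sided limits at $t_i$. With this $a$ held fixed, define for $\theta$ in a neighbourhood of $\theta^*$ $$J(\theta)=L\bigl(z(t_1;\theta),\dots,z(t_N;\theta)\bigr)+\int_{t_0}^{t_N}a(t)\bigl(\dot z(t;\theta)-f(t,z(t;\theta),\theta)\bigr)\,dt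 .$$ Then $J$ is differentiable at $\theta^*$ and $$\frac{dJ}{d\theta}(\theta^* )=-\int_{t_0}^{t_N}a(t)\,\frac{\partial f}{\partial\theta}\Big|_*\,dt .$$
   Context: Derivatives follow the Jacobian convention: $\bigl(\frac{\partial g}{\partial x}\bigr)_{ij}=\frac{\partial g_i}{\partial x_j}$. So $\frac{\partial f}{\partial z}$ is a $d\times d$ matrix, $\frac{\partial f}{\partial\theta}$ is a $d\times P$ matrix, and $\frac{\partial L}{\partial z_i}$ (the derivative of $L$ in its $i$-th argument) is a $1\times d$ row vector. The value $a(t_N^+)=0$ is a convention used to start the backward recursion. *)

theory Defs
  imports "HOL-Analysis.Analysis"
begin

text \<open>
  Row vectors in \<open>\<real>\<^bsup>1\<times>m\<^esup>\<close> are represented by \<open>real ^ 'm\<close>; they act on matrices from the left by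
  \<open>v*\<close> and on column vectors by \<open>\<bullet>\<close>. Matrix-valued derivatives are the library's \<open>jacobian\<close>;
  \<open>row_deriv\<close> is the corresponding \<open>1\<times>m\<close> Jacobian of a real-valued function.
\<close>

definition row_deriv :: "(real ^ 'm \<Rightarrow> real) \<Rightarrow> real ^ 'm \<Rightarrow> real ^ 'm" where
  "row_deriv g x = (\<chi> j. frechet_derivative g (at x) (axis j 1))"

definition partial_row_deriv ::
    "((real ^ 'd) ^ 'n \<Rightarrow> real) \<Rightarrow> 'n \<Rightarrow> (real ^ 'd) ^ 'n \<Rightarrow> real ^ 'd" where
  "partial_row_deriv L k Z = row_deriv (\<lambda>w. L (\<chi> j. if j = k then w else Z $ j)) (Z $ k)"

definition C2 :: "('a::real_normed_vector \<Rightarrow> 'b::real_normed_vector) \<Rightarrow> bool" where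
  "C2 g \<longleftrightarrow>
    (\<exists>(D1 :: 'a \<Rightarrow> 'a \<Rightarrow>\<^sub>L 'b) (D2 :: 'a \<Rightarrow> 'a \<Rightarrow>\<^sub>L ('a \<Rightarrow>\<^sub>L 'b)).
      (\<forall>x. (g has_derivative blinfun_apply (D1 x)) (at x)) \<and>
      (\<forall>x. (D1 has_derivative blinfun_apply (D2 x)) (at x)) \<and>
      continuous_on UNIV D2)"

definition C2_in_space ::
    "real set \<Rightarrow> (real \<Rightarrow> 'a::real_normed_vector \<Rightarrow> 'b::real_normed_vector) \<Rightarrow> bool" where
  "C2_in_space T g \<longleftrightarrow>
    (\<exists>(D1 :: real \<Rightarrow> 'a \<Rightarrow> 'a \<Rightarrow>\<^sub>L 'b) (D2 :: real \<Rightarrow> 'a \<Rightarrow> 'a \<Rightarrow>\<^sub>L ('a \<Rightarrow>\<^sub>L 'b)).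
      (\<forall>t\<in>T. \<forall>x. (g t has_derivative blinfun_apply (D1 t x)) (at x)) \<and>
      (\<forall>t\<in>T. \<forall>x. (D1 t has_derivative blinfun_apply (D2 t x)) (at x)) \<and>
      continuous_on (T \<times> UNIV) (\<lambda>(t, x). D1 t x) \<and>
      continuous_on (T \<times> UNIV) (\<lambda>(t, x). D2 t x))"

definition solves_ivp ::
    "(real \<Rightarrow> 'a::real_normed_vector \<Rightarrow> 'a) \<Rightarrow> real \<Rightarrow> real \<Rightarrow> 'a \<Rightarrow> (real \<Rightarrow> 'a) \<Rightarrow> bool" where
  "solves_ivp F s0 s1 y0 y \<longleftrightarrow>
    y s0 = y0 \<and>
    (\<forall>t\<in>{s0..s1}. (y has_vector_derivative F t (y t)) (at t within {s0..s1}))"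

text \<open>
  The \<open>N\<close> arguments of \<open>L\<close> are indexed by a finite type \<open>'n\<close>; \<open>pos k \<in> {1..N}\<close> is the position of
  argument \<open>k\<close>, so this is the tuple \<open>(y (t 1), \<dots>, y (t N))\<close>.
\<close>

definition samples :: "('n \<Rightarrow> nat) \<Rightarrow> (nat \<Rightarrow> real) \<Rightarrow> (real \<Rightarrow> real ^ 'd) \<Rightarrow> (real ^ 'd) ^ 'n" where
  "samples pos t y = (\<chi> k. y (t (pos k)))"

text \<open>
  The adjoint \<open>a\<close>; \<open>aminus i\<close> and \<open>aplus i\<close> are its one-sided limits at \<open>t i\<close>, where \<open>aplus N\<close> is only
  a convention (\<open>a\<close> is not considered beyond \<open>t N\<close>). The values of \<open>a\<close> at the points \<open>t i\<close> are left
  open. Continuity of the derivative of \<open>a\<close> on each piece, up to its end points, follows from the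
  differential equation.
\<close>

definition is_adjoint ::
    "nat \<Rightarrow> ('n \<Rightarrow> nat) \<Rightarrow> (nat \<Rightarrow> real) \<Rightarrow> (real \<Rightarrow> real ^ 'd \<Rightarrow> real ^ 'p \<Rightarrow> real ^ 'd) \<Rightarrow>
     ((real ^ 'd) ^ 'n \<Rightarrow> real) \<Rightarrow> (real \<Rightarrow> real ^ 'd) \<Rightarrow> real ^ 'p \<Rightarrow> (real \<Rightarrow> real ^ 'd) \<Rightarrow> bool" where
  "is_adjoint N pos t f L zs \<theta>s a \<longleftrightarrow>
    (\<exists>aminus aplus :: nat \<Rightarrow> real ^ 'd.
      (\<forall>i\<in>{1..N}. \<forall>s\<in>{t (i - 1)<..<t i}.
        (a has_vector_derivative - (a s v* jacobian (\<lambda>z. f s z \<theta>s) (at (zs s)))) (at s)) \<and>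
      (\<forall>i\<in>{1..N}. (a \<longlongrightarrow> aminus i) (at_left (t i))) \<and>
      (\<forall>i\<in>{0..<N}. (a \<longlongrightarrow> aplus i) (at_right (t i))) \<and>
      aplus N = 0 \<and>
      (\<forall>k. aminus (pos k) = aplus (pos k) - partial_row_deriv L k (samples pos t zs)))"

end

theory Submission
  imports Defs
begin

text \<open>
  Write \<open>\<delta> = z(\<cdot>;\<theta>) - z\<^sup>*\<close> and \<open>h = \<theta> - \<theta>\<^sup>*\<close>. Near \<open>\<theta>\<^sup>*\<close> the integral in \<open>J\<close> vanishes, so \<open>J\<close> is just \<open>L\<close>
  at the samples. By Gronwall \<open>\<delta> = O(|h|)\<close>, so \<open>\<delta>' = f\<^sub>z \<delta> + f\<^sub>\<theta> h + O(|h|\<^sup>2)\<close>, and on each piece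
  \<open>(a \<bullet> \<delta>)' = a \<bullet> f\<^sub>\<theta> h + O(|h|\<^sup>2)\<close>. Integrating and telescoping over the jumps of \<open>a\<close> gives
  \<open>\<Sum>\<^sub>i \<partial>L/\<partial>z\<^sub>i \<delta>(t\<^sub>i) = - \<integral> a f\<^sub>\<theta> h + O(|h|\<^sup>2)\<close>. Differentiability of \<open>z\<close> in \<open>\<theta>\<close>, and with it the
  variational equation, is never needed.
\<close>

section \<open>Initial value problems\<close>

lemma continuous_on_slices:
  assumes "continuous_on (T \<times> UNIV) (\<lambda>(s, x). D s x)"
    and "continuous_on S \<sigma>" "continuous_on S q" "\<And>r. r \<in> S \<Longrightarrow> \<sigma> r \<in> T"
  shows "continuous_on S (\<lambda>r. D (\<sigma> r) (q r))"
proof -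
  have "continuous_on S (\<lambda>r. (\<sigma> r, q r))"
    using assms by (intro continuous_intros)
  from continuous_on_compose2[OF assms(1) this] show ?thesis
    using assms(4) by auto
qed

lemma norm_le_gronwall:
  fixes u :: "real \<Rightarrow> 'a::real_inner"
  assumes u0: "u a = 0"
    and der: "\<And>s. s \<in> {a..b} \<Longrightarrow> (u has_vector_derivative u' s) (at s within {a..b})"
    and bnd: "\<And>s. s \<in> {a..b} \<Longrightarrow> norm (u' s) \<le> K * norm (u s) + m"
    and "0 \<le> m" "0 \<le> K" and s: "s \<in> {a..b}"
  shows "norm (u s) \<le> m * exp ((K + 1) * (b - a))"
proof -
  \<comment> \<open>An energy estimate: \<open>(|u|\<^sup>2)' \<le> (2 K + 1) |u|\<^sup>2 + m\<^sup>2\<close>.\<close>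
  define c where "c = 2 * K + 1"
  \<comment> \<open>\<open>g\<close> is \<open>|u|^2\<close> times an integrating factor, less the
    accumulated source term. As \<open>g a = 0\<close>, monotone decrease of \<open>g\<close> bounds
    \<open>|u|^2\<close>.\<close>
  define g where "g r = exp (- c * (r - a)) * (u r \<bullet> u r) - m\<^sup>2 * (r - a)" for r
  define g' where "g' r = exp (- c * (r - a)) * (2 * (u r \<bullet> u' r) - c * (u r \<bullet> u r)) - m\<^sup>2" for r
  have cu: "continuous_on {a..b} u"
    using der by (meson continuous_on_eq_continuous_within has_vector_derivative_continuous)
  have dg: "DERIV g r :> g' r" if "a < r" "r < b" for r
  proof -
    have "(u has_vector_derivative u' r) (at r)"
      using der[of r] that by (simp add: at_within_Icc_at)
    then have "(u has_derivative (\<lambda>h. h *\<^sub>R u' r)) (at r)"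
      by (simp add: has_vector_derivative_def)
    note [derivative_intros] = this
    show ?thesis
      unfolding g_def g'_def has_field_derivative_def
      by (rule has_derivative_eq_rhs, (rule derivative_intros refl)+)
        (auto simp: fun_eq_iff algebra_simps inner_commute)
  qed
  have energy: "2 * (u r \<bullet> u' r) - c * (u r \<bullet> u r) \<le> m\<^sup>2" if "r \<in> {a..b}" for r
  proof -
    have "u r \<bullet> u' r \<le> norm (u r) * (K * norm (u r) + m)"
      using norm_cauchy_schwarz bnd[OF that] by (meson mult_left_mono norm_ge_zero order_trans)
    \<comment> \<open>Expanded, this is \<open>2 m |u| \<le> |u|^2 + m^2\<close>, the origin of the
      \<open>+ 1\<close> in \<open>c\<close>.\<close>
    moreover have "0 \<le> (norm (u r) - m)\<^sup>2" by simp
    ultimately show ?thesis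
      by (simp add: c_def power2_norm_eq_inner[symmetric] power2_eq_square algebra_simps)
  qed
  have g'_le: "g' r \<le> 0" if "a < r" "r < b" for r
  proof -
    have "exp (- c * (r - a)) * (2 * (u r \<bullet> u' r) - c * (u r \<bullet> u r)) \<le> exp (- c * (r - a)) * m\<^sup>2"
      using that energy[of r] by (intro mult_left_mono) auto
    also have "\<dots> \<le> 1 * m\<^sup>2"
      using that \<open>0 \<le> K\<close> by (intro mult_right_mono) (auto simp: c_def mult_nonpos_nonneg)
    finally show ?thesis by (simp add: g'_def)
  qed
  have cg: "continuous_on {a..s} g"
    unfolding g_def using s
    by (intro continuous_intros continuous_on_subset[OF cu]) auto
  have "\<exists>y. DERIV g r :> y \<and> y \<le> 0" if "a < r" "r < s" for r
    using dg[of r] g'_le[of r] that s by auto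
  from DERIV_nonpos_imp_decreasing_open[OF _ this cg] have "g s \<le> g a"
    using s by simp
  then have "exp (- c * (s - a)) * (u s \<bullet> u s) \<le> m\<^sup>2 * (s - a)"
    by (simp add: g_def u0)
  moreover have "exp (- c * (s - a)) = 1 / exp (c * (s - a))"
    by (simp add: exp_minus inverse_eq_divide)
  ultimately have "u s \<bullet> u s \<le> m\<^sup>2 * (s - a) * exp (c * (s - a))"
    by (simp add: pos_divide_le_eq)
  \<comment> \<open>Bounding the factor \<open>s - a\<close> by an exponential turns the right-hand
    side into a perfect square, because \<open>1 + c = 2 (K + 1)\<close>.\<close>
  also have "\<dots> \<le> m\<^sup>2 * exp (b - a) * exp (c * (b - a))"
  proof (intro mult_mono)
    show "s - a \<le> exp (b - a)"
      using s exp_ge_add_one_self[of "b - a"] unfolding atLeastAtMost_iff by linarith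
  qed (use s \<open>0 \<le> K\<close> in \<open>auto simp: c_def mult_left_mono\<close>)
  also have "\<dots> = m\<^sup>2 * exp ((b - a) + c * (b - a))"
    by (simp add: exp_add)
  also have "(b - a) + c * (b - a) = 2 * ((K + 1) * (b - a))"
    by (simp add: c_def algebra_simps)
  also have "m\<^sup>2 * exp \<dots> = (m * exp ((K + 1) * (b - a)))\<^sup>2"
    by (simp add: power_mult_distrib exp_double)
  finally show ?thesis
    using \<open>0 \<le> m\<close> by (simp add: power2_norm_eq_inner[symmetric] power2_le_iff_abs_le)
qed

lemma solves_ivp_exists_lipschitz:
  fixes G :: "real \<Rightarrow> 'a::euclidean_space \<Rightarrow> 'a"
  assumes "a \<le> b" "0 \<le> K"
    and cont: "continuous_on ({a..b} \<times> UNIV) (\<lambda>(s, x). G s x)"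
    and lip: "\<And>s x y. s \<in> {a..b} \<Longrightarrow> norm (G s x - G s y) \<le> K * norm (x - y)"
  shows "\<exists>y. solves_ivp G a b y0 y"
proof -
  \<comment> \<open>Rescaling by the Bielecki weight \<open>w\<close> makes the Picard map a contraction on all of \<open>{a..b}\<close>;
    \<open>p\<close> extends functions constantly to \<open>\<real>\<close> because bounded continuous functions are total.\<close>
  define c where "c = 2 * K + 1"
  define w where "w r = exp (c * (r - a))" for r
  \<comment> \<open>The unknown is \<open>u = y / w\<close>: \<open>H\<close> is the Picard operator
    evaluated at \<open>y = w u\<close>, and \<open>S\<close> divides the result by
    \<open>w\<close>, so a fixed point of \<open>S\<close> yields a solution
    \<open>y\<close>.\<close>
  define H where "H u s = y0 + integral {a..s} (\<lambda>r. G r (w r *\<^sub>R u r))" for u :: "real \<Rightarrow> 'a" and s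
  define S where "S u s = (1 / w s) *\<^sub>R H u s" for u s
  define p where "p s = max a (min b s)" for s
  have w_pos: "w r > 0" for r by (simp add: w_def)
  have cw: "continuous_on X w" for X
    unfolding w_def by (intro continuous_intros)
  have p: "p s \<in> {a..b}" for s using \<open>a \<le> b\<close> by (auto simp: p_def)
  have p_id: "p s = s" if "s \<in> {a..b}" for s using that by (auto simp: p_def)
  have cp: "continuous_on X p" for X
    unfolding p_def by (intro continuous_intros)
  have cG: "continuous_on {a..b} (\<lambda>r. G r (w r *\<^sub>R u r))" if "continuous_on {a..b} u" for u
    by (rule continuous_on_slices[OF cont]) (auto intro!: continuous_intros cw that)
  have cH: "continuous_on {a..b} (H u)" if "continuous_on {a..b} u" for u
    unfolding H_def
    by (intro continuous_intros indefinite_integral_continuous_1 integrable_continuous_real cG that)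
  have cS: "continuous_on {a..b} (S u)" if "continuous_on {a..b} u" for u
    unfolding S_def using w_pos
    by (intro continuous_intros cw cH that) (simp add: less_imp_neq[THEN not_sym])
  have Sb: "(\<lambda>s. S u (p s)) \<in> bcontfun" if "continuous_on {a..b} u" for u
  proof -
    have "bounded (S u ` {a..b})"
      using compact_continuous_image[OF cS[OF that]] by (simp add: compact_imp_bounded)
    moreover have "range (\<lambda>s. S u (p s)) \<subseteq> S u ` {a..b}" using p by auto
    ultimately have "bounded (range (\<lambda>s. S u (p s)))" by (rule bounded_subset)
    moreover have "continuous_on UNIV (\<lambda>s. S u (p s))"
      using p by (intro continuous_on_compose2[OF cS[OF that] cp]) auto
    ultimately show ?thesis by (simp add: bcontfun_def)
  qed
  define T :: "(real \<Rightarrow>\<^sub>C 'a) \<Rightarrow> (real \<Rightarrow>\<^sub>C 'a)" where "T u = Bcontfun (\<lambda>s. S u (p s))" for u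
  have T: "apply_bcontfun (T u) = (\<lambda>s. S u (p s))" for u
    unfolding T_def by (intro Bcontfun_inverse Sb) simp
  have contr: "dist (T u) (T v) \<le> 1/2 * dist u v" for u v
  proof (rule dist_bound)
    fix s0
    define s where "s = p s0"
    have s: "s \<in> {a..b}" using p by (simp add: s_def)
    have int: "(\<lambda>r. G r (w r *\<^sub>R u r)) integrable_on {a..s}" for u :: "real \<Rightarrow>\<^sub>C 'a"
      using s by (intro integrable_continuous_real continuous_on_subset[OF cG]) auto
    \<comment> \<open>As \<open>2 K \<le> c\<close>, the integrand is at most \<open>c w k\<close>.
      The integral of this is at most \<open>w s * k\<close>, and dividing by \<open>w s\<close>
      leaves the contraction factor 1/2.\<close>
    define k where "k = dist u v / 2"
    have FTC: "((\<lambda>r. c * w r * k) has_integral (w s * k - w a * k)) {a..s}"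
      using s unfolding w_def
      by (intro fundamental_theorem_of_calculus)
        (auto intro!: derivative_eq_intros simp flip: has_real_derivative_iff_has_vector_derivative)
    have "norm (H u s - H v s) = norm (integral {a..s} (\<lambda>r. G r (w r *\<^sub>R u r) - G r (w r *\<^sub>R v r)))"
      by (simp add: H_def integral_diff[OF int int])
    also have "\<dots> \<le> integral {a..s} (\<lambda>r. c * w r * k)"
    proof (rule integral_norm_bound_integral)
      fix r assume r: "r \<in> {a..s}"
      have "norm (G r (w r *\<^sub>R u r) - G r (w r *\<^sub>R v r)) \<le> K * (w r * norm (u r - v r))"
        using lip[of r "w r *\<^sub>R u r" "w r *\<^sub>R v r"] r s w_pos[of r]
        by (simp flip: scaleR_diff_right)
      also have "norm (u r - v r) \<le> dist u v"
        using dist_bounded[of u r v] by (simp add: dist_norm)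
      also have "K * (w r * dist u v) \<le> c * w r * k"
        using w_pos[of r] by (simp add: c_def k_def algebra_simps)
      finally show "norm (G r (w r *\<^sub>R u r) - G r (w r *\<^sub>R v r)) \<le> c * w r * k"
        using \<open>0 \<le> K\<close> w_pos[of r] by (simp add: mult_left_mono)
    qed (use FTC int in \<open>auto intro!: integrable_diff\<close>)
    also have "\<dots> \<le> w s * k"
      unfolding integral_unique[OF FTC] using w_pos[of a] by (simp add: k_def)
    finally have "norm (S u s - S v s) \<le> k"
      using w_pos[of s] by (simp add: S_def divide_simps mult.commute flip: scaleR_diff_right)
    then show "dist (T u s0) (T v s0) \<le> 1/2 * dist u v"
      by (simp add: T s_def dist_norm k_def)
  qed
  obtain u where u: "T u = u"
    using banach_fix_type[of "1/2" T] contr by auto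
  define y where "y s = w s *\<^sub>R u s" for s
  have yH: "y s = H u s" if "s \<in> {a..b}" for s
  proof -
    have "u s = S u s" using that fun_cong[OF T[of u], of s] by (simp only: u p_id)
    then show ?thesis using w_pos[of s] by (simp add: y_def S_def)
  qed
  have "(H u has_vector_derivative G s (y s)) (at s within {a..b})" if "s \<in> {a..b}" for s
    unfolding H_def y_def
    using integral_has_vector_derivative[OF cG[of u] that]
    by (auto intro!: derivative_eq_intros)
  then have "(y has_vector_derivative G s (y s)) (at s within {a..b})" if "s \<in> {a..b}" for s
    using that by (metis (no_types, lifting) has_vector_derivative_transform yH)
  moreover have "y a = y0" using yH[of a] \<open>a \<le> b\<close> by (simp add: H_def)
  ultimately show ?thesis by (auto simp: solves_ivp_def)
qed

section \<open>Uniform estimates in a tube around a curve\<close>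

text \<open>Translating by \<open>p s\<close> turns the tube into the compact product
  \<open>{a..b} \<times> cball 0 R\<close>, on which a continuous function is bounded.\<close>

lemma tube_bounded:
  fixes D :: "real \<Rightarrow> 'c::{real_normed_vector,heine_borel} \<Rightarrow> 'e::real_normed_vector"
  assumes "continuous_on ({a..b} \<times> UNIV) (\<lambda>(s, x). D s x)" "continuous_on {a..b} p"
  shows "\<exists>M\<ge>0. \<forall>s\<in>{a..b}. \<forall>x\<in>cball (p s) R. norm (D s x) \<le> M"
proof -
  have "continuous_on ({a..b} \<times> cball 0 R) (\<lambda>(s, w). D s (p s + w))"
    unfolding case_prod_unfold
    by (rule continuous_on_slices[OF assms(1)])
      (auto intro!: continuous_intros continuous_on_compose2[OF assms(2)])
  then have "bounded ((\<lambda>(s, w). D s (p s + w)) ` ({a..b} \<times> cball 0 R))"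
    by (intro compact_imp_bounded compact_continuous_image compact_Times) auto
  then obtain M where M: "\<And>s w. s \<in> {a..b} \<Longrightarrow> norm w \<le> R \<Longrightarrow> norm (D s (p s + w)) \<le> M"
    by (force simp: bounded_iff)
  \<comment> \<open>The maximum secures a nonnegative constant: \<open>M\<close> may be negative if
    the interval or the ball is empty.\<close>
  have "norm (D s x) \<le> max M 0" if "s \<in> {a..b}" "x \<in> cball (p s) R" for s x
    using M[of s "x - p s"] that by (auto simp: dist_norm norm_minus_commute)
  then show ?thesis by (meson max.cobounded2)
qed

text \<open>The mean value inequality applies on each ball, which is convex, and the tube bound on
  the derivative makes the constant uniform in \<open>s\<close>.\<close>

lemma slice_lipschitz:
  fixes g :: "real \<Rightarrow> 'c::{real_normed_vector,heine_borel} \<Rightarrow> 'e::real_normed_vector"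
  assumes "C2_in_space {a..b} g" "continuous_on {a..b} p"
  shows "\<exists>K\<ge>0. \<forall>s\<in>{a..b}. \<forall>x\<in>cball (p s) R. \<forall>y\<in>cball (p s) R.
    norm (g s x - g s y) \<le> K * norm (x - y)"
proof -
  obtain D1 where der: "\<And>s x. s \<in> {a..b} \<Longrightarrow> (g s has_derivative blinfun_apply (D1 s x)) (at x)"
    and cont: "continuous_on ({a..b} \<times> UNIV) (\<lambda>(s, x). D1 s x)"
    using assms(1) unfolding C2_in_space_def by blast
  obtain K where "K \<ge> 0" and K: "\<And>s x. s \<in> {a..b} \<Longrightarrow> x \<in> cball (p s) R \<Longrightarrow> norm (D1 s x) \<le> K"
    using tube_bounded[OF cont assms(2), of R] by blast
  have "norm (g s x - g s y) \<le> K * norm (x - y)"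
    if "s \<in> {a..b}" "x \<in> cball (p s) R" "y \<in> cball (p s) R" for s x y
    using that K der
    by (intro differentiable_bound[of "cball (p s) R" "g s" "\<lambda>x. blinfun_apply (D1 s x)"])
      (auto intro: has_derivative_at_withinI simp flip: norm_blinfun.rep_eq)
  then show ?thesis using \<open>K \<ge> 0\<close> by blast
qed

text \<open>Two mean value inequalities on the ball of radius \<open>norm h\<close>: the bound on
  \<open>D2\<close> shows that \<open>D1 s\<close> moves by at most \<open>M * norm h\<close> from
  its value at the centre, and this in turn bounds the linearization error of
  \<open>g s\<close>.\<close>

lemma slice_taylor:
  fixes g :: "real \<Rightarrow> 'c::{real_normed_vector,heine_borel} \<Rightarrow> 'e::real_normed_vector"
  assumes der1: "\<And>s x. s \<in> {a..b} \<Longrightarrow> (g s has_derivative blinfun_apply (D1 s x)) (at x)"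
    and der2: "\<And>s x. s \<in> {a..b} \<Longrightarrow> (D1 s has_derivative blinfun_apply (D2 s x)) (at x)"
    and cont: "continuous_on ({a..b} \<times> UNIV) (\<lambda>(s, x). D2 s x)"
    and p: "continuous_on {a..b} p"
  shows "\<exists>M\<ge>0. \<forall>s\<in>{a..b}. \<forall>h. norm h \<le> R \<longrightarrow>
    norm (g s (p s + h) - g s (p s) - D1 s (p s) h) \<le> M * (norm h)\<^sup>2"
proof -
  obtain M where "M \<ge> 0" and M: "\<And>s x. s \<in> {a..b} \<Longrightarrow> x \<in> cball (p s) R \<Longrightarrow> norm (D2 s x) \<le> M"
    using tube_bounded[OF cont p, of R] by blast
  have "norm (g s (p s + h) - g s (p s) - D1 s (p s) h) \<le> M * (norm h)\<^sup>2"
    if s: "s \<in> {a..b}" and h: "norm h \<le> R" for s h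
  proof -
    define S where "S = cball (p s) (norm h)"
    have "norm (D1 s x - D1 s (p s)) \<le> M * norm (x - p s)" if "x \<in> S" for x
      using that M[OF s] der2[OF s] h
      by (intro differentiable_bound[of S "D1 s" "\<lambda>x. blinfun_apply (D2 s x)"])
        (auto intro: has_derivative_at_withinI simp: S_def simp flip: norm_blinfun.rep_eq)
    also have "M * norm (x - p s) \<le> M * norm h" if "x \<in> S" for x
      using that \<open>M \<ge> 0\<close> by (intro mult_left_mono) (auto simp: S_def dist_norm norm_minus_commute)
    finally have "norm (D1 s x - D1 s (p s)) \<le> M * norm h" if "x \<in> S" for x
      using that by simp
    then have "norm (g s (p s + h) - g s (p s) - D1 s (p s) (p s + h - p s))
        \<le> norm (p s + h - p s) * (M * norm h)"
      using der1[OF s]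
      by (intro differentiable_bound_linearization[where S = S and f' = "\<lambda>x. blinfun_apply (D1 s x)"])
        (auto intro: has_derivative_at_withinI mult_left_le_one_le
          simp: S_def dist_norm norm_blinfun.rep_eq minus_blinfun.rep_eq fun_diff_def)
    then show ?thesis by (simp add: power2_eq_square algebra_simps)
  qed
  then show ?thesis using \<open>M \<ge> 0\<close> by blast
qed

section \<open>Uniqueness and dependence on the parameter\<close>

lemma solves_ivp_continuous:
  "solves_ivp F a b y0 y \<Longrightarrow> continuous_on {a..b} y"
  unfolding solves_ivp_def
  by (meson continuous_on_eq_continuous_within has_vector_derivative_continuous)

text \<open>The field is only locally Lipschitz, but two continuous solutions on a compact interval
  differ by at most some \<open>R\<close>. Both thus lie in the tube of radius \<open>R\<close>
  around the first, and Gronwall with \<open>m = 0\<close> applies there.\<close>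

lemma solves_ivp_unique:
  fixes f :: "real \<Rightarrow> 'a::euclidean_space \<Rightarrow> 'b::euclidean_space \<Rightarrow> 'a"
  assumes C2: "C2_in_space {a..b} (\<lambda>s (x, \<theta>). f s x \<theta>)"
    and y1: "solves_ivp (\<lambda>s x. f s x \<theta>) a b y0 y1"
    and y2: "solves_ivp (\<lambda>s x. f s x \<theta>) a b y0 y2"
    and s: "s \<in> {a..b}"
  shows "y1 s = y2 s"
proof -
  note cont = solves_ivp_continuous[OF y1] solves_ivp_continuous[OF y2]
  have "bounded ((\<lambda>s. y2 s - y1 s) ` {a..b})"
    by (intro compact_imp_bounded compact_continuous_image continuous_intros cont compact_Icc)
  then obtain R where R: "\<And>s. s \<in> {a..b} \<Longrightarrow> norm (y2 s - y1 s) \<le> R" and "R \<ge> 0"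
    using s by (force simp: bounded_iff intro: order_trans[OF norm_ge_zero])
  have "continuous_on {a..b} (\<lambda>s. (y1 s, \<theta>))"
    by (intro continuous_intros cont)
  from slice_lipschitz[OF C2 this, of R] obtain K where "K \<ge> 0" and
    K: "\<And>s x y. s \<in> {a..b} \<Longrightarrow> x \<in> cball (y1 s, \<theta>) R \<Longrightarrow> y \<in> cball (y1 s, \<theta>) R \<Longrightarrow>
      norm ((case x of (x, \<theta>) \<Rightarrow> f s x \<theta>) - (case y of (x, \<theta>) \<Rightarrow> f s x \<theta>)) \<le> K * norm (x - y)"
    by blast
  have "norm (y1 s - y2 s) \<le> 0 * exp ((K + 1) * (b - a))"
  proof (rule norm_le_gronwall[where u = "\<lambda>s. y1 s - y2 s" and u' = "\<lambda>s. f s (y1 s) \<theta> - f s (y2 s) \<theta>"])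
    fix s assume "s \<in> {a..b}"
    then show "norm (f s (y1 s) \<theta> - f s (y2 s) \<theta>) \<le> K * norm (y1 s - y2 s) + 0"
      using K[of s "(y1 s, \<theta>)" "(y2 s, \<theta>)"] R[of s] \<open>R \<ge> 0\<close>
      by (simp add: dist_Pair_Pair dist_norm norm_minus_commute norm_Pair)
  qed (use y1 y2 s \<open>K \<ge> 0\<close> in \<open>auto simp: solves_ivp_def intro!: derivative_intros\<close>)
  then show ?thesis by simp
qed

text \<open>
  Outside the unit tube around the reference solution the vector field is replaced by its value at
  the nearest point of the tube. This makes it globally Lipschitz, and by Gronwall the solution for
  a nearby parameter never leaves the tube, so it solves the original equation.
\<close>

lemma solves_ivp_nearby:
  fixes f :: "real \<Rightarrow> 'a::euclidean_space \<Rightarrow> 'b::euclidean_space \<Rightarrow> 'a"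
  assumes "a \<le> b"
    and f_cont: "continuous_on ({a..b} \<times> UNIV \<times> UNIV) (\<lambda>(s, x, \<theta>). f s x \<theta>)"
    and C2: "C2_in_space {a..b} (\<lambda>s (x, \<theta>). f s x \<theta>)"
    and sol: "solves_ivp (\<lambda>s x. f s x \<theta>0) a b y0 y"
  shows "\<exists>C\<ge>0. \<exists>r>0. \<forall>\<theta>. norm (\<theta> - \<theta>0) < r \<longrightarrow>
    (\<exists>v. solves_ivp (\<lambda>s x. f s x \<theta>) a b y0 v \<and>
      (\<forall>s\<in>{a..b}. norm (v s - y s) \<le> C * norm (\<theta> - \<theta>0)))"
proof -
  note cy = solves_ivp_continuous[OF sol]
  have "continuous_on {a..b} (\<lambda>s. (y s, \<theta>0))"
    by (intro continuous_intros cy)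
  \<comment> \<open>Radius 2 leaves room for a perturbation of norm at most 1 in the state and
    another in the parameter.\<close>
  from slice_lipschitz[OF C2 this, of 2] obtain K where "K \<ge> 0" and
    K: "\<And>s x y'. s \<in> {a..b} \<Longrightarrow> x \<in> cball (y s, \<theta>0) 2 \<Longrightarrow> y' \<in> cball (y s, \<theta>0) 2 \<Longrightarrow>
      norm ((case x of (x, \<theta>) \<Rightarrow> f s x \<theta>) - (case y' of (x, \<theta>) \<Rightarrow> f s x \<theta>)) \<le> K * norm (x - y')"
    by blast
  have f_lip: "norm (f s (y s + u) \<theta> - f s (y s + u') \<theta>') \<le> K * (norm (u - u') + norm (\<theta> - \<theta>'))"
    if "s \<in> {a..b}" "norm u \<le> 1" "norm u' \<le> 1" "norm (\<theta> - \<theta>0) \<le> 1" "norm (\<theta>' - \<theta>0) \<le> 1" for s u u' \<theta> \<theta>'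
  proof -
    have mem: "(y s + v, \<theta>) \<in> cball (y s, \<theta>0) 2" if "norm v \<le> 1" "norm (\<theta> - \<theta>0) \<le> 1" for v \<theta>
      using that norm_Pair_le[of "- v" "\<theta>0 - \<theta>"] by (simp add: dist_norm norm_minus_commute)
    have "norm (f s (y s + u) \<theta> - f s (y s + u') \<theta>') \<le> K * norm (u - u', \<theta> - \<theta>')"
      using K[of s "(y s + u, \<theta>)" "(y s + u', \<theta>')"] mem that by simp
    also have "\<dots> \<le> K * (norm (u - u') + norm (\<theta> - \<theta>'))"
      using \<open>K \<ge> 0\<close> by (intro mult_left_mono norm_Pair_le)
    finally show ?thesis .
  qed
  define P where "P = closest_point (cball (0::'a) 1)"
  have P1: "norm (P u) \<le> 1" for u
    using closest_point_in_set[of "cball (0::'a) 1" u] by (simp add: P_def)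
  have P_id: "P u = u" if "norm u \<le> 1" for u
    using that by (simp add: P_def closest_point_self)
  have P_lip: "norm (P u - P v) \<le> norm (u - v)" for u v
    using closest_point_lipschitz[of "cball (0::'a) 1" u v] by (simp add: P_def dist_norm)
  have cP: "continuous_on X P" for X
    unfolding P_def by (intro continuous_on_closest_point) auto
  define E where "E = exp ((K + 1) * (b - a))"
  define C where "C = K * E"
  have "C \<ge> 0" using \<open>K \<ge> 0\<close> by (simp add: C_def E_def)
  \<comment> \<open>The radius \<open>1 / (C + 1)\<close> gives both
    \<open>norm (\<theta> - \<theta>0) \<le> 1\<close>, as \<open>f_lip\<close> requires, and
    \<open>C * norm (\<theta> - \<theta>0) \<le> 1\<close>, which keeps the solution in the unit
    tube.\<close>
  have "\<exists>v. solves_ivp (\<lambda>s x. f s x \<theta>) a b y0 v \<and>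
      (\<forall>s\<in>{a..b}. norm (v s - y s) \<le> C * norm (\<theta> - \<theta>0))"
    if "norm (\<theta> - \<theta>0) < 1 / (C + 1)" for \<theta>
  proof -
    have "1 / (C + 1) \<le> 1" using \<open>C \<ge> 0\<close> by (simp add: divide_simps)
    with that have \<theta>1: "norm (\<theta> - \<theta>0) \<le> 1" by simp
    have small: "C * norm (\<theta> - \<theta>0) \<le> 1"
    proof -
      have "C * norm (\<theta> - \<theta>0) \<le> C * (1 / (C + 1))"
        using that \<open>C \<ge> 0\<close> by (intro mult_left_mono) auto
      also have "\<dots> \<le> 1" using \<open>C \<ge> 0\<close> by (simp add: divide_simps)
      finally show ?thesis .
    qed
    \<comment> \<open>This is the truncated field for the difference from \<open>y\<close>, so the
      initial value is 0. At \<open>u = 0\<close> it only sees the change of parameter, which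
      supplies the source term \<open>K * norm (\<theta> - \<theta>0)\<close> in Gronwall.\<close>
    define G where "G s u = f s (y s + P u) \<theta> - f s (y s) \<theta>0" for s u
    have "continuous_on ({a..b} \<times> UNIV) (\<lambda>(s, u). G s u)"
    proof -
      have "continuous_on ({a..b} \<times> UNIV) (\<lambda>q. f (fst q) (y (fst q) + P (snd q)) \<theta>)"
        by (rule continuous_on_slices[where D = "\<lambda>s (x, \<theta>). f s x \<theta>" and T = "{a..b}"
              and q = "\<lambda>q. (y (fst q) + P (snd q), \<theta>)" and \<sigma> = fst, simplified])
          (use f_cont in \<open>auto intro!: continuous_intros continuous_on_compose2[OF cy]
            continuous_on_compose2[OF cP] simp: case_prod_unfold\<close>)
      moreover have "continuous_on ({a..b} \<times> UNIV) (\<lambda>q::real \<times> 'a. f (fst q) (y (fst q)) \<theta>0)"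
        by (rule continuous_on_slices[where D = "\<lambda>s (x, \<theta>). f s x \<theta>" and T = "{a..b}"
              and q = "\<lambda>q. (y (fst q), \<theta>0)" and \<sigma> = fst, simplified])
          (use f_cont in \<open>auto intro!: continuous_intros continuous_on_compose2[OF cy]
            simp: case_prod_unfold\<close>)
      ultimately show ?thesis
        unfolding G_def case_prod_unfold by (rule continuous_on_diff)
    qed
    moreover have "norm (G s u - G s v) \<le> K * norm (u - v)" if "s \<in> {a..b}" for s u v
    proof -
      have "norm (G s u - G s v) \<le> K * norm (P u - P v)"
        using f_lip[OF that P1 P1 \<theta>1 \<theta>1, of u v] by (simp add: G_def)
      also have "\<dots> \<le> K * norm (u - v)"
        using \<open>K \<ge> 0\<close> P_lip by (intro mult_left_mono)
      finally show ?thesis .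
    qed
    ultimately obtain u where u: "solves_ivp G a b 0 u"
      using solves_ivp_exists_lipschitz[OF \<open>a \<le> b\<close> \<open>K \<ge> 0\<close>] by blast
    have u_le: "norm (u s) \<le> C * norm (\<theta> - \<theta>0)" if s: "s \<in> {a..b}" for s
    proof -
      have "norm (u s) \<le> (K * norm (\<theta> - \<theta>0)) * exp ((K + 1) * (b - a))"
      proof (rule norm_le_gronwall[where u' = "\<lambda>s. G s (u s)"])
        fix s assume s: "s \<in> {a..b}"
        have "norm (G s (u s)) \<le> K * (norm (P (u s)) + norm (\<theta> - \<theta>0))"
          using f_lip[OF s P1 _ \<theta>1, of 0 \<theta>0 "u s"] by (simp add: G_def)
        also have "\<dots> \<le> K * (norm (u s) + norm (\<theta> - \<theta>0))"
          using \<open>K \<ge> 0\<close> P_lip[of "u s" 0] by (intro mult_left_mono) (auto simp: P_id)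
        finally show "norm (G s (u s)) \<le> K * norm (u s) + K * norm (\<theta> - \<theta>0)"
          by (simp add: algebra_simps)
      qed (use u s \<open>K \<ge> 0\<close> in \<open>auto simp: solves_ivp_def\<close>)
      then show ?thesis by (simp add: C_def E_def mult_ac)
    qed
    have "solves_ivp (\<lambda>s x. f s x \<theta>) a b y0 (\<lambda>s. y s + u s)"
    proof -
      have "((\<lambda>s. y s + u s) has_vector_derivative f s (y s + u s) \<theta>) (at s within {a..b})"
        if s: "s \<in> {a..b}" for s
      proof -
        have "((\<lambda>s. y s + u s) has_vector_derivative f s (y s) \<theta>0 + G s (u s)) (at s within {a..b})"
          using sol u s by (auto simp: solves_ivp_def intro!: derivative_intros)
        moreover have "P (u s) = u s"
          using u_le[OF s] small by (intro P_id) simp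
        ultimately show ?thesis by (simp add: G_def)
      qed
      then show ?thesis using sol u by (simp add: solves_ivp_def)
    qed
    then show ?thesis using u_le by (intro exI[of _ "\<lambda>s. y s + u s"]) simp
  qed
  moreover have "1 / (C + 1) > 0" using \<open>C \<ge> 0\<close> by simp
  ultimately show ?thesis using \<open>C \<ge> 0\<close> by blast
qed

section \<open>Row derivatives and adjoints\<close>

lemma inner_row_deriv:
  assumes "(g has_derivative D) (at x)"
  shows "row_deriv g x \<bullet> h = D h"
proof -
  have lin: "linear D" using assms by (rule has_derivative_linear)
  have "D h = D (\<Sum>j\<in>UNIV. h $ j *\<^sub>R axis j 1)"
    by (simp add: basis_expansion flip: scalar_mult_eq_scaleR)
  also have "\<dots> = (\<Sum>j\<in>UNIV. h $ j * D (axis j 1))"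
    by (simp add: linear_sum[OF lin] linear_scale[OF lin])
  finally show ?thesis
    by (simp add: row_deriv_def inner_vec_def mult.commute flip: frechet_derivative_at[OF assms])
qed

lemma inner_vector_matrix_jacobian:
  fixes g :: "real ^ 'm \<Rightarrow> real ^ 'k"
  assumes "(g has_derivative D) (at x)"
  shows "(r v* jacobian g (at x)) \<bullet> h = r \<bullet> D h"
proof -
  have "g differentiable at x" using assms by (rule differentiableI)
  then have "(g has_derivative (*v) (jacobian g (at x))) (at x)"
    unfolding jacobian_works .
  with assms have "D = (*v) (jacobian g (at x))" by (rule has_derivative_unique)
  then show ?thesis by (simp add: dot_lmul_matrix)
qed

text \<open>Replacing the \<open>k\<close>-th argument by \<open>w\<close> is the affine map
  \<open>w \<mapsto> Z + axis k (w - Z $ k)\<close>. By the chain rule the \<open>k\<close>-th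
  partial derivative is \<open>D\<close> restricted to the \<open>k\<close>-th block, and
  \<open>D\<close> is the sum of its restrictions.\<close>

lemma derivative_eq_sum_partial_row_deriv:
  fixes L :: "(real ^ 'd) ^ 'n::finite \<Rightarrow> real"
  assumes L: "(L has_derivative D) (at Z)"
  shows "D w = (\<Sum>k\<in>UNIV. partial_row_deriv L k Z \<bullet> w $ k)"
proof -
  have lin: "linear D" using L by (rule has_derivative_linear)
  have "partial_row_deriv L k Z \<bullet> v = D (axis k v)" for k v
  proof -
    define ins where "ins w = (\<chi> j. if j = k then w else Z $ j)" for w
    have "ins = (\<lambda>w. Z + axis k (w - Z $ k))"
      by (simp add: ins_def fun_eq_iff vec_eq_iff axis_def)
    moreover have "bounded_linear (\<lambda>v::real ^ 'd. axis k v :: (real ^ 'd) ^ 'n)"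
      by (rule linear_conv_bounded_linear[THEN iffD1], rule linearI) (simp_all add: vec_eq_iff axis_def)
    from bounded_linear.has_derivative[OF this]
    have "((\<lambda>w. Z + axis k (w - Z $ k)) has_derivative (\<lambda>v. 0 + axis k (v - 0))) (at (Z $ k))"
      by (rule has_derivative_add[OF has_derivative_const])
        (intro has_derivative_diff has_derivative_const has_derivative_ident)
    ultimately have "(ins has_derivative axis k) (at (Z $ k))"
      by simp
    moreover have "ins (Z $ k) = Z" by (simp add: ins_def vec_eq_iff)
    ultimately have "((\<lambda>w. L (ins w)) has_derivative (\<lambda>v. D (axis k v))) (at (Z $ k))"
      using L by (auto intro: has_derivative_compose)
    from inner_row_deriv[OF this] show ?thesis
      by (simp add: partial_row_deriv_def ins_def)
  qed
  moreover have "w = (\<Sum>k\<in>UNIV. axis k (w $ k))"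
    by (simp add: vec_eq_iff axis_def sum.delta)
  then have "D w = (\<Sum>k\<in>UNIV. D (axis k (w $ k)))"
    by (metis linear_sum[OF lin])
  ultimately show ?thesis by simp
qed

text \<open>A substitute for the chain rule when \<open>F\<close> is not known to be differentiable.
  The remainder of \<open>L\<close> is small relative to \<open>|F x - F x0|\<close>, hence to
  \<open>|x - x0|\<close>, and \<open>DL\<close> of the increment of \<open>F\<close> agrees with
  \<open>D\<close> up to a quadratic error.\<close>

lemma has_derivative_composed_to_second_order:
  fixes F :: "'a::real_normed_vector \<Rightarrow> 'b::real_normed_vector"
    and L :: "'b \<Rightarrow> 'c::real_normed_vector"
  assumes L: "(L has_derivative DL) (at (F x0))" and D: "bounded_linear D"
    and ev: "\<forall>\<^sub>F x in nhds x0. J x = L (F x) \<and> norm (F x - F x0) \<le> C * norm (x - x0) \<and>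
      norm (DL (F x - F x0) - D (x - x0)) \<le> Q * (norm (x - x0))\<^sup>2"
  shows "(J has_derivative D) (at x0)"
  unfolding has_derivative_at_alt
proof (intro conjI D allI impI)
  fix e :: real assume "e > 0"
  \<comment> \<open>\<open>C\<close> and \<open>Q\<close> may have either sign; their majorants are
    positive and can be divided by.\<close>
  define C' where "C' = \<bar>C\<bar> + 1"
  define Q' where "Q' = \<bar>Q\<bar> + 1"
  have pos: "C' > 0" "Q' > 0" "C \<le> C'" "Q \<le> Q'" by (auto simp: C'_def Q'_def)
  obtain d1 where "d1 > 0" and d1: "\<And>x. norm (x - x0) < d1 \<Longrightarrow>
      J x = L (F x) \<and> norm (F x - F x0) \<le> C * norm (x - x0) \<and>
      norm (DL (F x - F x0) - D (x - x0)) \<le> Q * (norm (x - x0))\<^sup>2"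
    using ev by (auto simp: eventually_nhds_metric dist_norm)
  have "e / (2 * C') > 0" using \<open>e > 0\<close> pos by simp
  then obtain d2 where "d2 > 0" and d2: "\<And>y. norm (y - F x0) < d2 \<Longrightarrow>
      norm (L y - L (F x0) - DL (y - F x0)) \<le> e / (2 * C') * norm (y - F x0)"
    using L unfolding has_derivative_at_alt by blast
  \<comment> \<open>The three bounds give, in turn, the assumed estimates, closeness of
    \<open>F x\<close> to \<open>F x0\<close> as needed for \<open>L\<close>, and a quadratic error
    of at most \<open>e / 2 * norm (x - x0)\<close>.\<close>
  define d where "d = min d1 (min (d2 / C') (e / (2 * Q')))"
  have "norm (J x - J x0 - D (x - x0)) \<le> e * norm (x - x0)" if x: "norm (x - x0) < d" for x
  proof -
    let ?h = "norm (x - x0)"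
    have h: "?h < d1" "C' * ?h < d2" "Q' * ?h \<le> e / 2"
      using x pos by (auto simp: d_def field_simps)
    have F: "norm (F x - F x0) \<le> C' * ?h"
      using d1[OF h(1)] mult_right_mono[OF pos(3), of ?h] by simp
    have "norm (L (F x) - L (F x0) - DL (F x - F x0)) \<le> e / (2 * C') * norm (F x - F x0)"
      using F h by (intro d2) simp
    also have "\<dots> \<le> e / (2 * C') * (C' * ?h)"
      using F \<open>e > 0\<close> pos by (intro mult_left_mono) auto
    also have "\<dots> = e / 2 * ?h" using pos by simp
    finally have 1: "norm (L (F x) - L (F x0) - DL (F x - F x0)) \<le> e / 2 * ?h" .
    have "norm (DL (F x - F x0) - D (x - x0)) \<le> Q * ?h\<^sup>2"
      using d1[OF h(1)] by simp
    also have "\<dots> \<le> Q' * ?h * ?h"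
      using mult_right_mono[OF pos(4), of "?h\<^sup>2"] by (simp add: power2_eq_square mult.assoc)
    also have "\<dots> \<le> e / 2 * ?h"
      using h(3) by (intro mult_right_mono) auto
    finally have 2: "norm (DL (F x - F x0) - D (x - x0)) \<le> e / 2 * ?h" .
    \<comment> \<open>A neighbourhood of \<open>x0\<close> contains \<open>x0\<close> itself, so
      \<open>J x0 = L (F x0)\<close> as well.\<close>
    have "J x - J x0 - D (x - x0) =
        (L (F x) - L (F x0) - DL (F x - F x0)) + (DL (F x - F x0) - D (x - x0))"
      using d1[OF h(1)] d1[of x0] \<open>d1 > 0\<close> by simp
    then have "norm (J x - J x0 - D (x - x0)) \<le> e / 2 * ?h + e / 2 * ?h"
      using norm_triangle_mono[OF 1 2] by (simp only:)
    then show ?thesis by simp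
  qed
  moreover have "d > 0" using \<open>d1 > 0\<close> \<open>d2 > 0\<close> \<open>e > 0\<close> pos by (simp add: d_def)
  ultimately show "\<exists>d>0. \<forall>x. norm (x - x0) < d \<longrightarrow> norm (J x - J x0 - D (x - x0)) \<le> e * norm (x - x0)"
    by blast
qed

section \<open>Piecewise integration\<close>

lemma mono_on_step:
  fixes t :: "nat \<Rightarrow> real"
  assumes "mono_on {0..N} t" "Suc n \<le> N"
  shows "t 0 \<le> t n" "t n \<le> t (Suc n)"
  using assms by (auto intro!: mono_onD[OF assms(1)])

lemma has_integral_pieces:
  fixes g :: "real \<Rightarrow> 'a::banach" and t :: "nat \<Rightarrow> real"
  assumes mono: "mono_on {0..N} t"
    and int: "\<And>i. i \<in> {1..N} \<Longrightarrow> (g has_integral I i) {t (i - 1)..t i}"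
  shows "(g has_integral (\<Sum>i=1..N. I i)) {t 0..t N}"
proof -
  have "(g has_integral (\<Sum>i=1..n. I i)) {t 0..t n}" if "n \<le> N" for n
    using that
  proof (induction n)
    case (Suc n)
    then show ?case
      using has_integral_combine[OF mono_on_step[OF mono Suc.prems], of g _ "I (Suc n)"] int[of "Suc n"]
      by simp
  qed (simp add: has_integral_refl)
  then show ?thesis by blast
qed

lemma bounded_image_pieces:
  fixes t :: "nat \<Rightarrow> real"
  assumes mono: "mono_on {0..N} t"
    and bnd: "\<And>i. i \<in> {1..N} \<Longrightarrow> bounded (g ` {t (i - 1)..t i})"
  shows "bounded (g ` {t 0..t N})"
proof -
  have "bounded (g ` {t 0..t n})" if "n \<le> N" for n
    using that
  proof (induction n)
    case (Suc n)
    have "{t 0..t (Suc n)} = {t 0..t n} \<union> {t n..t (Suc n)}"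
      using mono_on_step[OF mono Suc.prems] by auto
    then show ?case using Suc bnd[of "Suc n"] by (simp add: image_Un)
  qed simp
  then show ?thesis by blast
qed

text \<open>The adjoint has prescribed one-sided limits at the nodes but arbitrary values there. On
  each closed piece it is therefore replaced by an extension taking those limits as end
  values.\<close>

lemma continuous_extension_Icc:
  fixes g :: "real \<Rightarrow> 'a::topological_space"
  assumes "\<alpha> < \<beta>" and cont: "continuous_on {\<alpha><..<\<beta>} g"
    and lim: "(g \<longlongrightarrow> l) (at_right \<alpha>)" "(g \<longlongrightarrow> r) (at_left \<beta>)"
  obtains G where "continuous_on {\<alpha>..\<beta>} G" "G \<alpha> = l" "G \<beta> = r"
    "\<And>s. s \<in> {\<alpha><..<\<beta>} \<Longrightarrow> G s = g s"
proof
  define G where "G s = (if s \<le> \<alpha> then l else if s \<ge> \<beta> then r else g s)" for s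
  show eq: "G s = g s" if "s \<in> {\<alpha><..<\<beta>}" for s
    using that by (simp add: G_def)
  show "G \<alpha> = l" "G \<beta> = r" using \<open>\<alpha> < \<beta>\<close> by (simp_all add: G_def)
  show "continuous_on {\<alpha>..\<beta>} G"
  proof (rule continuous_on_IccI[OF _ _ _ \<open>\<alpha> < \<beta>\<close>])
    have "\<forall>\<^sub>F s in at_right \<alpha>. g s = G s"
      unfolding eventually_at_right_field using \<open>\<alpha> < \<beta>\<close> eq by (intro exI[of _ \<beta>]) auto
    then show "(G \<longlongrightarrow> G \<alpha>) (at_right \<alpha>)"
      using lim(1) by (simp add: \<open>G \<alpha> = l\<close> filterlim_cong)
    have "\<forall>\<^sub>F s in at_left \<beta>. g s = G s"
      unfolding eventually_at_left_field using \<open>\<alpha> < \<beta>\<close> eq by (intro exI[of _ \<alpha>]) auto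
    then show "(G \<longlongrightarrow> G \<beta>) (at_left \<beta>)"
      using lim(2) by (simp add: \<open>G \<beta> = r\<close> filterlim_cong)
    fix s assume s: "\<alpha> < s" "s < \<beta>"
    have "continuous_on {\<alpha><..<\<beta>} G"
      using cont by (rule continuous_on_eq) (simp add: eq)
    then show "G \<midarrow>s\<rightarrow> G s"
      using s by (simp add: continuous_on_eq_continuous_at isCont_def)
  qed
qed

text \<open>The adjoint equation makes the integrand the derivative of
  \<open>a \<bullet> \<delta>\<close> inside the piece. The fundamental theorem is applied to the
  continuous extension of \<open>a\<close>, so the one-sided limits appear in the boundary
  terms.\<close>

lemma adjoint_integration_by_parts:
  fixes a :: "real \<Rightarrow> real ^ 'd" and A :: "real \<Rightarrow> real ^ 'd ^ 'd"
  assumes "\<alpha> < \<beta>"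
    and a: "\<And>s. s \<in> {\<alpha><..<\<beta>} \<Longrightarrow> (a has_vector_derivative - (a s v* A s)) (at s)"
    and lim: "(a \<longlongrightarrow> l) (at_right \<alpha>)" "(a \<longlongrightarrow> r) (at_left \<beta>)"
    and \<delta>: "\<And>s. s \<in> {\<alpha>..\<beta>} \<Longrightarrow> (\<delta> has_vector_derivative \<delta>' s) (at s within {\<alpha>..\<beta>})"
  shows "((\<lambda>s. a s \<bullet> (\<delta>' s - A s *v \<delta> s)) has_integral (r \<bullet> \<delta> \<beta> - l \<bullet> \<delta> \<alpha>)) {\<alpha>..\<beta>}"
proof -
  have "continuous_on {\<alpha><..<\<beta>} a"
    using a by (meson continuous_at_imp_continuous_on has_vector_derivative_continuous)
  then obtain G where G: "continuous_on {\<alpha>..\<beta>} G" "G \<alpha> = l" "G \<beta> = r"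
    and eq: "\<And>s. s \<in> {\<alpha><..<\<beta>} \<Longrightarrow> G s = a s"
    using continuous_extension_Icc[OF \<open>\<alpha> < \<beta>\<close> _ lim] by blast
  have "((\<lambda>s. a s \<bullet> (\<delta>' s - A s *v \<delta> s)) has_integral (G \<beta> \<bullet> \<delta> \<beta> - G \<alpha> \<bullet> \<delta> \<alpha>)) {\<alpha>..\<beta>}"
  proof (rule fundamental_theorem_of_calculus_interior)
    have "continuous_on {\<alpha>..\<beta>} \<delta>"
      using \<delta> by (meson continuous_on_eq_continuous_within has_vector_derivative_continuous)
    then show "continuous_on {\<alpha>..\<beta>} (\<lambda>s. G s \<bullet> \<delta> s)"
      by (intro continuous_intros G)
    fix s assume s: "s \<in> {\<alpha><..<\<beta>}"
    have "(G has_vector_derivative - (a s v* A s)) (at s)"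
      by (rule has_vector_derivative_transform_within_open[OF a[OF s] open_greaterThanLessThan s])
        (simp add: eq)
    moreover have "(\<delta> has_vector_derivative \<delta>' s) (at s)"
      using \<delta>[of s] s by (simp add: at_within_Icc_at)
    ultimately have "((\<lambda>s. G s \<bullet> \<delta> s) has_vector_derivative G s \<bullet> \<delta>' s + - (a s v* A s) \<bullet> \<delta> s) (at s)"
      by (rule bounded_bilinear.has_vector_derivative[OF bounded_bilinear_inner])
    then show "((\<lambda>s. G s \<bullet> \<delta> s) has_vector_derivative a s \<bullet> (\<delta>' s - A s *v \<delta> s)) (at s)"
      using s by (simp add: eq inner_diff_right dot_lmul_matrix)
  qed (use \<open>\<alpha> < \<beta>\<close> in simp)
  then show ?thesis by (simp add: G)
qed

section \<open>The sensitivity formula\<close>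

theorem mainTheorem2:
  fixes N :: nat
    and pos :: "'n::finite \<Rightarrow> nat"
    and t :: "nat \<Rightarrow> real"
    and f :: "real \<Rightarrow> real ^ 'd \<Rightarrow> real ^ 'p \<Rightarrow> real ^ 'd"
    and L :: "(real ^ 'd) ^ 'n \<Rightarrow> real"
    and z0 :: "real ^ 'd"
    and z :: "real ^ 'p \<Rightarrow> real \<Rightarrow> real ^ 'd"
    and \<theta>s :: "real ^ 'p"
    and a :: "real \<Rightarrow> real ^ 'd"
    and J :: "real ^ 'p \<Rightarrow> real"
  assumes pos: "bij_betw pos UNIV {1..N}"
    and t_mono: "strict_mono_on {0..N} t"
    and f_cont: "continuous_on ({t 0..t N} \<times> UNIV \<times> UNIV) (\<lambda>(s, x, \<theta>). f s x \<theta>)"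
    and f_C2: "C2_in_space {t 0..t N} (\<lambda>s (x, \<theta>). f s x \<theta>)"
    and L_C2: "C2 L"
    and z_sol: "\<And>\<theta>. (\<exists>y. solves_ivp (\<lambda>s x. f s x \<theta>) (t 0) (t N) z0 y) \<Longrightarrow>
                  solves_ivp (\<lambda>s x. f s x \<theta>) (t 0) (t N) z0 (z \<theta>)"
    and zs_exists: "\<exists>y. solves_ivp (\<lambda>s x. f s x \<theta>s) (t 0) (t N) z0 y"
    and a_adj: "is_adjoint N pos t f L (z \<theta>s) \<theta>s a"
    and J_eq: "\<forall>\<^sub>F \<theta> in nhds \<theta>s.
      J \<theta> = L (samples pos t (z \<theta>)) +
        integral {t 0..t N}
          (\<lambda>s. a s \<bullet> (vector_derivative (z \<theta>) (at s within {t 0..t N}) - f s (z \<theta> s) \<theta>))"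
  shows "(\<forall>\<^sub>F \<theta> in nhds \<theta>s. solves_ivp (\<lambda>s x. f s x \<theta>) (t 0) (t N) z0 (z \<theta>)) \<and>
    J differentiable (at \<theta>s) \<and>
    (\<lambda>s. a s v* jacobian (\<lambda>\<theta>. f s (z \<theta>s s) \<theta>) (at \<theta>s)) integrable_on {t 0..t N} \<and>
    row_deriv J \<theta>s =
      - integral {t 0..t N} (\<lambda>s. a s v* jacobian (\<lambda>\<theta>. f s (z \<theta>s s) \<theta>) (at \<theta>s))"
proof -

  \<comment> \<open>Reference trajectory and partial Jacobians\<close>
  let ?I = "{t 0..t N}"
  define zs where "zs = z \<theta>s"
  have mono: "mono_on {0..N} t"
    using t_mono by (rule strict_mono_on_imp_mono_on)
  have pos_mem: "pos k \<in> {1..N}" for k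
    using pos by (auto simp: bij_betw_def)
  \<comment> \<open>The index type is inhabited, so \<open>{1..N}\<close> cannot be empty.\<close>
  have N: "1 \<le> N" using pos_mem by force
  have step: "t (i - 1) < t i" if "i \<in> {1..N}" for i
    using that by (intro strict_mono_onD[OF t_mono]) auto
  have piece: "{t (i - 1)..t i} \<subseteq> ?I" if "i \<in> {1..N}" for i
    using that by (intro atLeastatMost_subset_iff[THEN iffD2] disjI2 conjI mono_onD[OF mono]) auto
  have t_mem: "t i \<in> ?I" if "i \<in> {0..N}" for i
    using that by (auto intro!: mono_onD[OF mono])
  have "t 0 < t N"
    using N by (intro strict_mono_onD[OF t_mono]) auto
  have zs: "solves_ivp (\<lambda>s x. f s x \<theta>s) (t 0) (t N) z0 zs"
    unfolding zs_def by (rule z_sol[OF zs_exists])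
  obtain D1 D2 where
    D1: "\<And>s x. s \<in> ?I \<Longrightarrow> ((\<lambda>(x, \<theta>). f s x \<theta>) has_derivative blinfun_apply (D1 s x)) (at x)"
    and D2: "\<And>s x. s \<in> ?I \<Longrightarrow> (D1 s has_derivative blinfun_apply (D2 s x)) (at x)"
    and D1_cont: "continuous_on (?I \<times> UNIV) (\<lambda>(s, x). D1 s x)"
    and D2_cont: "continuous_on (?I \<times> UNIV) (\<lambda>(s, x). D2 s x)"
    using f_C2 unfolding C2_in_space_def by blast
  \<comment> \<open>The reference curve is taken in the joint space of state and parameter, so one
    tube controls both variables.\<close>
  define p where "p s = (zs s, \<theta>s)" for s
  have p_cont: "continuous_on ?I p"
    unfolding p_def by (intro continuous_intros solves_ivp_continuous[OF zs])
  have der_z: "((\<lambda>x. f s x \<theta>s) has_derivative (\<lambda>u. D1 s (p s) (u, 0))) (at (zs s))" if "s \<in> ?I" for s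
  proof -
    have "((\<lambda>x. (x, \<theta>s)) has_derivative (\<lambda>u. (u, 0))) (at (zs s))"
      by (intro derivative_intros)
    from has_derivative_compose[OF this D1[OF that]] show ?thesis by (simp add: p_def)
  qed
  have der_\<theta>: "((\<lambda>\<theta>. f s (zs s) \<theta>) has_derivative (\<lambda>h. D1 s (p s) (0, h))) (at \<theta>s)" if "s \<in> ?I" for s
  proof -
    have "((\<lambda>\<theta>. (zs s, \<theta>)) has_derivative (\<lambda>h. (0, h))) (at \<theta>s)"
      by (intro derivative_intros)
    from has_derivative_compose[OF this D1[OF that]] show ?thesis by (simp add: p_def)
  qed
  define A where "A s = jacobian (\<lambda>x. f s x \<theta>s) (at (zs s))" for s
  have A_mult: "A s *v u = D1 s (p s) (u, 0)" if "s \<in> ?I" for s u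
  proof -
    have "(\<lambda>x. f s x \<theta>s) differentiable at (zs s)"
      using der_z[OF that] by (rule differentiableI)
    from has_derivative_unique[OF der_z[OF that] this[unfolded jacobian_works]]
    show ?thesis by (simp add: A_def fun_eq_iff)
  qed
  define c where "c s = a s v* jacobian (\<lambda>\<theta>. f s (zs s) \<theta>) (at \<theta>s)" for s
  have c_inner: "c s \<bullet> h = a s \<bullet> D1 s (p s) (0, h)" if "s \<in> ?I" for s h
    unfolding c_def by (rule inner_vector_matrix_jacobian[OF der_\<theta>[OF that]])

  \<comment> \<open>Integrability and boundedness along the adjoint\<close>
  obtain am ap where
    a_ode: "\<And>i s. i \<in> {1..N} \<Longrightarrow> s \<in> {t (i - 1)<..<t i} \<Longrightarrow>
      (a has_vector_derivative - (a s v* A s)) (at s)"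
    and am: "\<And>i. i \<in> {1..N} \<Longrightarrow> (a \<longlongrightarrow> am i) (at_left (t i))"
    and ap: "\<And>i. i \<in> {0..<N} \<Longrightarrow> (a \<longlongrightarrow> ap i) (at_right (t i))"
    and apN: "ap N = 0"
    and jump: "\<And>k. am (pos k) = ap (pos k) - partial_row_deriv L k (samples pos t zs)"
    using a_adj unfolding is_adjoint_def zs_def[symmetric] A_def[symmetric] by blast
  \<comment> \<open>Piece \<open>i\<close> starts at node \<open>i - 1\<close>, so its left boundary
    term carries the index \<open>i - 1\<close>.\<close>
  have ap': "(a \<longlongrightarrow> ap (i - 1)) (at_right (t (i - 1)))" if "i \<in> {1..N}" for i
    using that by (intro ap) auto
  have a_ext: "\<exists>G. continuous_on {t (i - 1)..t i} G \<and> (\<forall>s\<in>{t (i - 1)<..<t i}. G s = a s)"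
    if i: "i \<in> {1..N}" for i
  proof -
    have "continuous_on {t (i - 1)<..<t i} a"
      using a_ode[OF i] by (meson continuous_at_imp_continuous_on has_vector_derivative_continuous)
    from continuous_extension_Icc[OF step[OF i] this ap'[OF i] am[OF i]] show ?thesis by metis
  qed

  \<comment> \<open>On each piece \<open>c\<close> agrees, except possibly at the two end points,
    with a continuous function built from the extension of \<open>a\<close>.\<close>
  have "c integrable_on {t (i - 1)..t i}" if i: "i \<in> {1..N}" for i
  proof -
    obtain G where G: "continuous_on {t (i - 1)..t i} G"
      and eq: "\<And>s. s \<in> {t (i - 1)<..<t i} \<Longrightarrow> G s = a s"
      using a_ext[OF i] by blast
    have "continuous_on {t (i - 1)..t i} (\<lambda>s. D1 s (p s))"
      by (rule continuous_on_slices[OF D1_cont])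
        (use piece[OF i] in \<open>auto intro: continuous_on_subset[OF p_cont]\<close>)
    then have "continuous_on {t (i - 1)..t i} (\<lambda>s. \<chi> j. G s \<bullet> D1 s (p s) (0, axis j 1))"
      by (intro continuous_on_vec_lambda continuous_intros G)
    then have "(\<lambda>s. \<chi> j. G s \<bullet> D1 s (p s) (0, axis j 1)) integrable_on {t (i - 1)..t i}"
      by (rule integrable_continuous_real)
    then show ?thesis
    proof (rule integrable_spike_finite[where S = "{t (i - 1), t i}", rotated 2])
      fix s assume s: "s \<in> {t (i - 1)..t i} - {t (i - 1), t i}"
      then have "s \<in> ?I" "G s = a s"
        using piece[OF i] eq[of s] by auto
      then have "c s $ j = G s \<bullet> D1 s (p s) (0, axis j 1)" for j
        using c_inner[of s "axis j 1"] by (simp add: inner_axis)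
      then show "c s = (\<chi> j. G s \<bullet> D1 s (p s) (0, axis j 1))"
        by (simp add: vec_eq_iff)
    qed simp
  qed
  then have "(c has_integral (\<Sum>i=1..N. integral {t (i - 1)..t i} c)) ?I"
    by (intro has_integral_pieces[OF mono] integrable_integral)
  then have c_int: "c integrable_on ?I"
    by (rule has_integral_integrable)
  \<comment> \<open>The final estimate needs a bound at every point of the interval, so the
    unconstrained values of \<open>a\<close> at the nodes are included.\<close>
  have "bounded (a ` {t (i - 1)..t i})" if i: "i \<in> {1..N}" for i
  proof -
    obtain G where G: "continuous_on {t (i - 1)..t i} G"
      and eq: "\<And>s. s \<in> {t (i - 1)<..<t i} \<Longrightarrow> G s = a s"
      using a_ext[OF i] by blast
    have "bounded (G ` {t (i - 1)..t i} \<union> {a (t (i - 1)), a (t i)})"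
      using compact_continuous_image[OF G] by (simp add: compact_imp_bounded)
    moreover have "a ` {t (i - 1)..t i} \<subseteq> G ` {t (i - 1)..t i} \<union> {a (t (i - 1)), a (t i)}"
    proof
      fix v assume "v \<in> a ` {t (i - 1)..t i}"
      then obtain s where s: "v = a s" "s \<in> {t (i - 1)..t i}" by blast
      then have "s \<in> {t (i - 1)<..<t i} \<or> s = t (i - 1) \<or> s = t i" by auto
      then show "v \<in> G ` {t (i - 1)..t i} \<union> {a (t (i - 1)), a (t i)}"
        using s eq[of s] by (auto intro!: image_eqI[of _ _ s])
    qed
    ultimately show ?thesis by (rule bounded_subset)
  qed
  from bounded_image_pieces[OF mono this] obtain Ma where Ma: "\<And>s. s \<in> ?I \<Longrightarrow> norm (a s) \<le> Ma"
    unfolding bounded_iff by blast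
  have "Ma \<ge> 0" using order_trans[OF norm_ge_zero Ma[OF t_mem[of 0]]] by simp

  \<comment> \<open>Solutions for nearby parameters\<close>
  obtain C r where "C \<ge> 0" "r > 0" and near: "\<And>\<theta>. norm (\<theta> - \<theta>s) < r \<Longrightarrow>
      \<exists>v. solves_ivp (\<lambda>s x. f s x \<theta>) (t 0) (t N) z0 v \<and>
        (\<forall>s\<in>?I. norm (v s - zs s) \<le> C * norm (\<theta> - \<theta>s))"
    using solves_ivp_nearby[OF less_imp_le[OF \<open>t 0 < t N\<close>] f_cont f_C2 zs] by blast
  have sol: "solves_ivp (\<lambda>s x. f s x \<theta>) (t 0) (t N) z0 (z \<theta>)" if "norm (\<theta> - \<theta>s) < r" for \<theta>
    using near[OF that] z_sol by blast
  \<comment> \<open>\<open>near\<close> bounds some solution; uniqueness transfers the bound to the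
    chosen \<open>z \<theta>\<close>.\<close>
  have z_le: "norm (z \<theta> s - zs s) \<le> C * norm (\<theta> - \<theta>s)" if "norm (\<theta> - \<theta>s) < r" "s \<in> ?I" for \<theta> s
    using near[OF that(1)] solves_ivp_unique[OF f_C2 sol[OF that(1)] _ that(2)] that(2) by metis
  obtain M where "M \<ge> 0" and M: "\<And>s h. s \<in> ?I \<Longrightarrow> norm h \<le> 1 \<Longrightarrow>
      norm ((case p s + h of (x, \<theta>) \<Rightarrow> f s x \<theta>) - (case p s of (x, \<theta>) \<Rightarrow> f s x \<theta>) - D1 s (p s) h)
        \<le> M * (norm h)\<^sup>2"
    using slice_taylor[OF D1 D2 D2_cont p_cont, of 1] by blast

  define DL where "DL = frechet_derivative L (at (samples pos t zs))"
  have DL: "(L has_derivative DL) (at (samples pos t zs))"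
    using L_C2 unfolding C2_def DL_def by (metis frechet_derivative_at)
  \<comment> \<open>The product of the bound on \<open>a\<close>, the Taylor constant for an
    increment of norm at most \<open>(C + 1) |h|\<close>, and the length of the interval.\<close>
  define Q where "Q = Ma * (M * (C + 1)\<^sup>2) * (t N - t 0)"
  \<comment> \<open>The second bound keeps the joint increment \<open>(\<delta> s, h)\<close> within
    norm 1, where the Taylor estimate \<open>M\<close> holds.\<close>
  define d where "d = min r (1 / (C + 1))"
  have "d > 0" using \<open>r > 0\<close> \<open>C \<ge> 0\<close> by (simp add: d_def)

  \<comment> \<open>The adjoint identity up to second order\<close>
  have adjoint_estimate: "norm (DL (samples pos t (z \<theta>) - samples pos t zs) - (- integral ?I c \<bullet> (\<theta> - \<theta>s)))
      \<le> Q * (norm (\<theta> - \<theta>s))\<^sup>2"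
    if "norm (\<theta> - \<theta>s) < d" for \<theta>
  proof -
    define h where "h = \<theta> - \<theta>s"
    have h: "norm h < r" "(C + 1) * norm h \<le> 1"
      using that \<open>C \<ge> 0\<close> by (auto simp: d_def h_def field_simps)
    define \<delta> where "\<delta> = (\<lambda>s. z \<theta> s - zs s)"
    define \<delta>' where "\<delta>' s = f s (z \<theta> s) \<theta> - f s (zs s) \<theta>s" for s
    have \<delta>: "(\<delta> has_vector_derivative \<delta>' s) (at s within ?I)" if "s \<in> ?I" for s
      using sol[of \<theta>] h zs that
      by (auto simp: \<delta>_def \<delta>'_def h_def solves_ivp_def intro!: derivative_intros)
    have \<delta>_t0: "\<delta> (t 0) = 0"
      using sol[of \<theta>] h zs by (simp add: \<delta>_def h_def solves_ivp_def)
    \<comment> \<open>The two subtracted linear terms add up to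
      \<open>D1 s (p s) (\<delta> s, h)\<close>, so this is the Taylor remainder of the field in
      state and parameter jointly.\<close>
    have remainder: "norm (\<delta>' s - A s *v \<delta> s - D1 s (p s) (0, h)) \<le> M * (C + 1)\<^sup>2 * (norm h)\<^sup>2"
      if s: "s \<in> ?I" for s
    proof -
      have "norm (\<delta> s, h) \<le> norm (\<delta> s) + norm h" by (rule norm_Pair_le)
      also have "\<dots> \<le> (C + 1) * norm h"
        using z_le[of \<theta> s] h s by (simp add: \<delta>_def h_def algebra_simps)
      finally have le: "norm (\<delta> s, h) \<le> (C + 1) * norm h" .
      have "D1 s (p s) (\<delta> s, h) = D1 s (p s) (\<delta> s, 0) + D1 s (p s) (0, h)"
        by (simp flip: blinfun.add_right)
      then have "\<delta>' s - A s *v \<delta> s - D1 s (p s) (0, h) =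
          (case p s + (\<delta> s, h) of (x, \<theta>) \<Rightarrow> f s x \<theta>) - (case p s of (x, \<theta>) \<Rightarrow> f s x \<theta>) - D1 s (p s) (\<delta> s, h)"
        by (simp add: A_mult[OF s] \<delta>'_def p_def \<delta>_def h_def)
      then have "norm (\<delta>' s - A s *v \<delta> s - D1 s (p s) (0, h)) \<le> M * (norm (\<delta> s, h))\<^sup>2"
        using M[OF s, of "(\<delta> s, h)"] le h by simp
      also have "\<dots> \<le> M * ((C + 1) * norm h)\<^sup>2"
        using le \<open>M \<ge> 0\<close> by (intro mult_left_mono power_mono) auto
      finally show ?thesis by (simp add: power_mult_distrib mult.assoc)
    qed
    \<comment> \<open>The sum of all boundary terms from integrating by parts piece by
      piece.\<close>
    define T where "T = (\<Sum>i=1..N. am i \<bullet> \<delta> (t i) - ap (i - 1) \<bullet> \<delta> (t (i - 1)))"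
    have "((\<lambda>s. a s \<bullet> (\<delta>' s - A s *v \<delta> s)) has_integral T) ?I"
      unfolding T_def
    proof (rule has_integral_pieces[OF mono])
      fix i assume i: "i \<in> {1..N}"
      have "(\<delta> has_vector_derivative \<delta>' s) (at s within {t (i - 1)..t i})"
        if "s \<in> {t (i - 1)..t i}" for s
        using has_vector_derivative_within_subset[OF \<delta> piece[OF i]] piece[OF i] that by blast
      from adjoint_integration_by_parts[OF step[OF i] a_ode[OF i] ap'[OF i] am[OF i] this]
      show "((\<lambda>s. a s \<bullet> (\<delta>' s - A s *v \<delta> s)) has_integral
          am i \<bullet> \<delta> (t i) - ap (i - 1) \<bullet> \<delta> (t (i - 1))) {t (i - 1)..t i}" .
    qed
    moreover have "((\<lambda>s. c s \<bullet> h) has_integral (integral ?I c \<bullet> h)) ?I"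
      using has_integral_linear[OF integrable_integral[OF c_int] bounded_linear_inner_left]
      by (simp add: o_def)
    ultimately have int: "((\<lambda>s. a s \<bullet> (\<delta>' s - A s *v \<delta> s) - c s \<bullet> h) has_integral
        T - integral ?I c \<bullet> h) (cbox (t 0) (t N))"
      unfolding box_real by (rule has_integral_diff)
    define B where "B = Ma * (M * (C + 1)\<^sup>2 * (norm h)\<^sup>2)"
    have "B \<ge> 0" using \<open>Ma \<ge> 0\<close> \<open>M \<ge> 0\<close> by (simp add: B_def)
    have "norm (a s \<bullet> (\<delta>' s - A s *v \<delta> s) - c s \<bullet> h) \<le> B" if "s \<in> cbox (t 0) (t N)" for s
    proof -
      have s: "s \<in> ?I" using that by simp
      have "norm (a s \<bullet> (\<delta>' s - A s *v \<delta> s) - c s \<bullet> h) =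
          \<bar>a s \<bullet> (\<delta>' s - A s *v \<delta> s - D1 s (p s) (0, h))\<bar>"
        by (simp add: c_inner[OF s] inner_diff_right)
      also have "\<dots> \<le> norm (a s) * norm (\<delta>' s - A s *v \<delta> s - D1 s (p s) (0, h))"
        by (rule Cauchy_Schwarz_ineq2)
      also have "\<dots> \<le> B"
        unfolding B_def using Ma[OF s] remainder[OF s] \<open>Ma \<ge> 0\<close> by (intro mult_mono) auto
      finally show ?thesis .
    qed
    from has_integral_bound[OF \<open>B \<ge> 0\<close> int this]
    have "norm (T - integral ?I c \<bullet> h) \<le> B * (t N - t 0)"
      using \<open>t 0 < t N\<close> by simp
    moreover have "T = - DL (samples pos t (z \<theta>) - samples pos t zs)"
    proof -
      \<comment> \<open>Adding and subtracting \<open>ap i\<close> at each node separates the jumps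
        from a telescoping sum. The latter vanishes since \<open>\<delta> (t 0) = 0\<close> and
        \<open>ap N = 0\<close>; the jumps, reindexed by \<open>pos\<close>, assemble the derivative
        of \<open>L\<close>.\<close>
      have "T = (\<Sum>i=1..N. (am i - ap i) \<bullet> \<delta> (t i)) +
          (\<Sum>i=1..N. ap i \<bullet> \<delta> (t i) - ap (i - 1) \<bullet> \<delta> (t (i - 1)))"
        unfolding T_def sum.distrib[symmetric] by (intro sum.cong) (auto simp: inner_diff_left)
      also have "(\<Sum>i=1..N. ap i \<bullet> \<delta> (t i) - ap (i - 1) \<bullet> \<delta> (t (i - 1))) = 0"
        using sum_telescope''[of 0 N "\<lambda>i. ap i \<bullet> \<delta> (t i)"] by (simp add: apN \<delta>_t0)
      also have "(\<Sum>i=1..N. (am i - ap i) \<bullet> \<delta> (t i)) = (\<Sum>k\<in>UNIV. (am (pos k) - ap (pos k)) \<bullet> \<delta> (t (pos k)))"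
        by (rule sum.reindex_bij_betw[OF pos, symmetric])
      also have "\<dots> = - (\<Sum>k\<in>UNIV. partial_row_deriv L k (samples pos t zs) \<bullet> \<delta> (t (pos k)))"
        by (simp add: jump sum_negf)
      also have "\<dots> = - DL (samples pos t (z \<theta>) - samples pos t zs)"
        by (simp add: derivative_eq_sum_partial_row_deriv[OF DL] samples_def \<delta>_def)
      finally show ?thesis by simp
    qed
    ultimately show ?thesis
      by (simp add: Q_def B_def h_def mult_ac abs_le_iff)
  qed

  \<comment> \<open>Differentiability of \<open>J\<close>\<close>
  have samples_le: "norm (samples pos t (z \<theta>) - samples pos t zs) \<le> real CARD('n) * C * norm (\<theta> - \<theta>s)"
    if "norm (\<theta> - \<theta>s) < d" for \<theta>
  proof -
    have "norm (samples pos t (z \<theta>) - samples pos t zs)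
        \<le> (\<Sum>k\<in>UNIV. norm ((samples pos t (z \<theta>) - samples pos t zs) $ k))"
      unfolding norm_vec_def by (rule L2_set_le_sum) simp
    also have "\<dots> \<le> (\<Sum>k\<in>(UNIV::'n set). C * norm (\<theta> - \<theta>s))"
      using that t_mem pos_mem by (intro sum_mono) (auto simp: samples_def d_def intro!: z_le)
    finally show ?thesis by simp
  qed

  have J_L: "J \<theta> = L (samples pos t (z \<theta>))"
    if "norm (\<theta> - \<theta>s) < d" and J: "J \<theta> = L (samples pos t (z \<theta>)) +
      integral ?I (\<lambda>s. a s \<bullet> (vector_derivative (z \<theta>) (at s within ?I) - f s (z \<theta> s) \<theta>))" for \<theta>
  proof -
    \<comment> \<open>Derivatives within a nondegenerate closed interval are unique, so the
      integrand vanishes at every point, the end points included.\<close>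
    have "vector_derivative (z \<theta>) (at s within ?I) = f s (z \<theta> s) \<theta>" if s: "s \<in> ?I" for s
      using sol[of \<theta>] \<open>norm (\<theta> - \<theta>s) < d\<close> s
      by (intro vector_derivative_within_closed_interval[OF \<open>t 0 < t N\<close> s])
        (auto simp: d_def solves_ivp_def)
    then have "integral ?I (\<lambda>s. a s \<bullet> (vector_derivative (z \<theta>) (at s within ?I) - f s (z \<theta> s) \<theta>))
        = integral ?I (\<lambda>s. 0)"
      by (intro integral_cong) simp
    then show ?thesis using J by simp
  qed

  have near_ev: "\<forall>\<^sub>F \<theta> in nhds \<theta>s. norm (\<theta> - \<theta>s) < d"
    using \<open>d > 0\<close> by (auto simp: eventually_nhds_metric dist_norm)
  have J_der: "(J has_derivative (\<lambda>h. - integral ?I c \<bullet> h)) (at \<theta>s)"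
  proof (rule has_derivative_composed_to_second_order[where F = "\<lambda>\<theta>. samples pos t (z \<theta>)"])
    show "(L has_derivative DL) (at (samples pos t (z \<theta>s)))"
      using DL by (simp add: zs_def)
    show "bounded_linear (\<lambda>h. - integral ?I c \<bullet> h)"
      by (rule bounded_linear_inner_right)
    show "\<forall>\<^sub>F \<theta> in nhds \<theta>s. J \<theta> = L (samples pos t (z \<theta>)) \<and>
        norm (samples pos t (z \<theta>) - samples pos t (z \<theta>s)) \<le> real CARD('n) * C * norm (\<theta> - \<theta>s) \<and>
        norm (DL (samples pos t (z \<theta>) - samples pos t (z \<theta>s)) - (- integral ?I c \<bullet> (\<theta> - \<theta>s)))
          \<le> Q * (norm (\<theta> - \<theta>s))\<^sup>2"
      using near_ev J_eq
      by eventually_elim (use J_L samples_le adjoint_estimate in \<open>auto simp only: zs_def\<close>)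
  qed
  have "row_deriv J \<theta>s = - integral ?I c"
    using inner_row_deriv[OF J_der] by (metis vector_eq_rdot)
  moreover have "\<forall>\<^sub>F \<theta> in nhds \<theta>s. solves_ivp (\<lambda>s x. f s x \<theta>) (t 0) (t N) z0 (z \<theta>)"
    using near_ev by eventually_elim (auto simp: d_def intro: sol)
  moreover have "J differentiable (at \<theta>s)"
    using J_der by (rule differentiableI)
  ultimately show ?thesis
    using c_int unfolding c_def zs_def by blast
qed

end
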